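(* Let $r,n$ be positive integers and $\epsilon\in\{1,-1\}$. Then the following identities of polynomials in $q$ hold. (i) For any $w\in S_n$, $$\sum_{\pi\in G^*_{r,n}(w)}\epsilon^{\mathrm{inv}(|\pi|)}q^{\mathrm{Dmaj}(\pi)}=\epsilon^{\mathrm{inv}(w)}q^{\mathrm{maj}(w)}\cdot[r]_{q}[r]_{q^2}\cdots[r]_{q^{n-1}}.$$ (ii) $$\sum_{\pi\in G^*_{r,n}}\epsilon^{\mathrm{inv}(|\pi|)}q^{\mathrm{Dmaj}(\pi)}=[r]_{q}[2r]_{\epsilon q}\cdots[(n-1)r]_{\epsilon^{n}q}\,[n]_{\epsilon^{n-1}q},$$ where for $1\le i\le n-1$ the $i$th factor is $[ir]_{\epsilon^{i-1}q}$ (note $\epsilon^{n}=\epsilon^{n-2}$) and the last factor is $[n]_{\epsilon^{n-1}q}$.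
   Context: Here $q$ is an indeterminate and $[m]_x:=1+x+\cdots+x^{m-1}$ for an integer $m\ge 0$. Empty products equal $1$. $G_{r,n}=\mathbb{Z}_r\wr S_n$ is the group of colored permutations: its elements are $\pi=(\pi_1,\dots,\pi_n)=(\sigma_1^{z_1},\dots,\sigma_n^{z_n})$ with $\sigma=(\sigma_1,\dots,\sigma_n)\in S_n$ (one-line notation) and colors $z_i\in\{0,\dots,r-1\}$. Write $|\pi|=\sigma$, $|\pi_i|=\sigma_i$ (regarded as a colored integer of color $0$), and $\mathrm{col}(\pi)=z_1+\cdots+z_n$ (sum of integers). A colored integer of color $0$ is written without exponent. For $\sigma\in S_n$, $\mathrm{inv}(\sigma)=\#\{i<j:\sigma_i>\sigma_j\}$ and $\mathrm{maj}(\sigma)=\sum_{i:\sigma_i>\sigma_{i+1}}i$. Colored integers are compared in the linear order $$1^{r-1}<\cdots<n^{r-1}<\cdots<1^1<\cdots<n^1<1<\cdots<n.$$ With this order, $\mathrm{maj}_F(\pi)=\sum_{1\le i\le n-1,\ \pi_i>\pi_{i+1}}i$ and $\mathrm{fmaj}(\pi)=r\cdot\mathrm{maj}_F(\pi)+\mathrm{col}(\pi)$. $G^*_{r,n}=\{\pi\in G_{r,n}:\mathrm{col}(\pi)\equiv 0\pmod r\}$, and for $w\in S_n$, $G^*_{r,n}(w)=\{\pi\in G^*_{r,n}:|\pi|=w\}$. For $\pi\in G^*_{r,n}$, $\mathrm{Dmaj}(\pi):=\mathrm{fmaj}\big((\pi_1,\dots,\pi_{n-1},|\pi_n|)\big)$.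 *)

theory Defs
  imports "HOL-Combinatorics.Combinatorics" "HOL-Computational_Algebra.Polynomial"
begin

(* A permutation in S_n is its one-line notation, an element of permutations_of_set {1..n}.
   Lists are indexed from 0, so the paper's entry sigma_i is sigma ! (i - 1). *)

definition inversions :: "nat list \<Rightarrow> nat" where
  "inversions \<sigma> = card {(i, j). i < j \<and> j < length \<sigma> \<and> \<sigma> ! i > \<sigma> ! j}"

definition major_index :: "nat list \<Rightarrow> nat" where
  "major_index \<sigma> = (\<Sum>i | i \<in> {1..<length \<sigma>} \<and> \<sigma> ! (i - 1) > \<sigma> ! i. i)"

(* The pair (a, z) is the colored integer a^z. *)
type_synonym colored = "nat \<times> nat"

(* 1^(r-1) < ... < n^(r-1) < ... < 1^1 < ... < n^1 < 1 < ... < n: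
   a larger color makes a smaller colored integer. *)
definition colored_less :: "colored \<Rightarrow> colored \<Rightarrow> bool" where
  "colored_less x y \<longleftrightarrow> snd x > snd y \<or> (snd x = snd y \<and> fst x < fst y)"

definition uncolor :: "colored \<Rightarrow> colored" where
  "uncolor x = (fst x, 0)"

definition underlying :: "colored list \<Rightarrow> nat list" where
  "underlying \<pi> = map fst \<pi>"

definition col :: "colored list \<Rightarrow> nat" where
  "col \<pi> = sum_list (map snd \<pi>)"

definition colored_perms :: "nat \<Rightarrow> nat \<Rightarrow> colored list set" where
  "colored_perms r n =
     {\<pi>. underlying \<pi> \<in> permutations_of_set {1..n} \<and> (\<forall>x \<in> set \<pi>. snd x < r)}"

definition colored_perms_star :: "nat \<Rightarrow> nat \<Rightarrow> colored list set" where
  "colored_perms_star r n = {\<pi> \<in> colored_perms r n. r dvd col \<pi>}"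

definition colored_perms_star_over :: "nat \<Rightarrow> nat \<Rightarrow> nat list \<Rightarrow> colored list set" where
  "colored_perms_star_over r n w = {\<pi> \<in> colored_perms_star r n. underlying \<pi> = w}"

definition maj_F :: "colored list \<Rightarrow> nat" where
  "maj_F \<pi> = (\<Sum>i | i \<in> {1..<length \<pi>} \<and> colored_less (\<pi> ! i) (\<pi> ! (i - 1)). i)"

definition fmaj :: "nat \<Rightarrow> colored list \<Rightarrow> nat" where
  "fmaj r \<pi> = r * maj_F \<pi> + col \<pi>"

definition Dmaj :: "nat \<Rightarrow> colored list \<Rightarrow> nat" where
  "Dmaj r \<pi> = fmaj r (butlast \<pi> @ [uncolor (last \<pi>)])"

definition q_bracket :: "nat \<Rightarrow> 'a::comm_semiring_1 \<Rightarrow> 'a" where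
  "q_bracket m x = (\<Sum>i<m. x ^ i)"

(* The indeterminate of the polynomial ring Z[q]. *)
definition qq :: "int poly" where
  "qq = [:0, 1:]"

lemma finite_colored_perms: "finite (colored_perms r n)"
proof (rule finite_subset)
  show "colored_perms r n \<subseteq> {xs. set xs \<subseteq> {1..n} \<times> {..<r} \<and> length xs = n}"
  proof
    fix p assume "p \<in> colored_perms r n"
    then have s: "set (map fst p) = {1..n}" and d: "distinct (map fst p)"
      and c: "\<forall>x \<in> set p. snd x < r"
      by (auto simp: colored_perms_def underlying_def permutations_of_set_def)
    have "length p = n" using distinct_card[OF d] s by simp
    moreover have "fst x \<in> {1..n}" if "x \<in> set p" for x
      using that s by (metis image_eqI set_map)
    ultimately show "p \<in> {xs. set xs \<subseteq> {1..n} \<times> {..<r} \<and> length xs = n}"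
      using c by (auto simp: mem_Times_iff)
  qed
qed (simp add: finite_lists_length_eq)

end

theory Submission
  imports Defs
begin

text \<open>
  \<open>Dmaj\<close> ignores the last color, which is determined by the others, so the last color may be taken
  to be \<open>0\<close>. Grouping \<open>fmaj\<close> by positions writes it as the sum of \<open>i * \<delta>\<^sub>i\<close>, where
  \<open>\<delta>\<^sub>i = z\<^sub>i - z\<^sub>i\<^sub>+\<^sub>1\<close>, plus \<open>r\<close> at a descent. For a given color \<open>z\<^sub>i\<^sub>+\<^sub>1\<close>, as \<open>z\<^sub>i\<close> varies, \<open>\<delta>\<^sub>i\<close> runs
  through \<open>r\<close> consecutive values, starting at \<open>1\<close> if the underlying permutation has a descent at \<open>i\<close>
  and at \<open>0\<close> otherwise. This gives (i).

  For (ii) it remains to compute the sum of \<open>\<epsilon> ^ inv w * q ^ maj w\<close> over the symmetric group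
  (a theorem of Gessel and Simion if \<open>\<epsilon> = -1\<close>). Lowering all values of \<open>w\<close> cyclically by one
  multiplies the sign by \<open>(-1) ^ (n - 1)\<close> and raises \<open>maj w\<close> by one, unless the last value is \<open>1\<close>;
  hence the permutations are sorted by their last value, and those with last value \<open>n\<close> are the
  permutations of \<open>n - 1\<close> letters.
\<close>

section \<open>Coloring a fixed permutation\<close>

lemma major_index_snoc:
  "major_index (u @ [b, a]) = major_index (u @ [b]) + (if a < b then Suc (length u) else 0)"
proof -
  have "{i. i \<in> {1..<length (u @ [b, a])} \<and> (u @ [b, a]) ! (i - 1) > (u @ [b, a]) ! i}
      = {i. i \<in> {1..<length (u @ [b])} \<and> (u @ [b]) ! (i - 1) > (u @ [b]) ! i}
        \<union> (if a < b then {Suc (length u)} else {})"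
    by (auto simp: nth_append less_Suc_eq)
  then show ?thesis
    unfolding major_index_def by (simp add: sum.insert_if)
qed

lemma maj_F_snoc:
  "maj_F (u @ [b, a]) = maj_F (u @ [b]) + (if colored_less a b then Suc (length u) else 0)"
proof -
  have "{i. i \<in> {1..<length (u @ [b, a])} \<and> colored_less ((u @ [b, a]) ! i) ((u @ [b, a]) ! (i - 1))}
      = {i. i \<in> {1..<length (u @ [b])} \<and> colored_less ((u @ [b]) ! i) ((u @ [b]) ! (i - 1))}
        \<union> (if colored_less a b then {Suc (length u)} else {})"
    by (auto simp: nth_append less_Suc_eq)
  then show ?thesis
    unfolding maj_F_def by (simp add: sum.insert_if)
qed

lemma fmaj_snoc:
  "fmaj r (u @ [b, a]) =
     fmaj r (u @ [b]) + snd a + Suc (length u) * (if colored_less a b then r else 0)"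
  by (simp add: fmaj_def maj_F_snoc col_def algebra_simps)

text \<open>The exponents \<open>z < e\<close> move up by \<open>r\<close>, past the remaining ones,
  so all \<open>r\<close> exponents together fill the block from \<open>e\<close> to
  \<open>e + r - 1\<close>. This is the sum over the color of one letter, with \<open>e\<close>
  marking where descents stop.\<close>

lemma q_bracket_shift_residues:
  fixes x :: "'a::comm_semiring_1"
  assumes "e \<le> r"
  shows "(\<Sum>z<r. x ^ (z + (if z < e then r else 0))) = x ^ e * q_bracket r x"
proof -
  have "{..<r} = {..<e} \<union> {e..<r}" "{..<e} \<inter> {e..<r} = {}"
    using assms by auto
  then have "(\<Sum>z<r. x ^ (z + (if z < e then r else 0)))
      = (\<Sum>z<e. x ^ (z + (if z < e then r else 0))) + (\<Sum>z=e..<r. x ^ (z + (if z < e then r else 0)))"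
    by (simp add: sum.union_disjoint)
  also have "(\<Sum>z<e. x ^ (z + (if z < e then r else 0))) = (\<Sum>z=r..<e+r. x ^ z)"
    using sum.shift_bounds_nat_ivl[of "\<lambda>z. x ^ z" 0 r e] by (simp add: atLeast0LessThan)
  also have "(\<Sum>z=e..<r. x ^ (z + (if z < e then r else 0))) = (\<Sum>z=e..<r. x ^ z)"
    by simp
  also have "(\<Sum>z=r..<e+r. x ^ z) + (\<Sum>z=e..<r. x ^ z) = (\<Sum>z=e..<r+e. x ^ z)"
    using sum.atLeastLessThan_concat[of e r "e + r" "\<lambda>z. x ^ z"] assms
    by (simp add: add.commute)
  also have "\<dots> = x ^ e * q_bracket r x"
    using sum.shift_bounds_nat_ivl[of "\<lambda>z. x ^ z" 0 e r]
    by (simp add: atLeast0LessThan q_bracket_def sum_distrib_left power_add mult.commute)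
  finally show ?thesis .
qed

text \<open>All colorings, with no condition on the color sum and for an arbitrary list
  \<open>u\<close>, so that the last letter can be removed in an induction.\<close>

definition colorings :: "nat \<Rightarrow> nat list \<Rightarrow> colored list set" where
  "colorings r u = {\<pi>. underlying \<pi> = u \<and> (\<forall>x \<in> set \<pi>. snd x < r)}"

lemma colorings_Nil: "colorings r [] = {[]}"
  by (auto simp: colorings_def underlying_def)

lemma length_colorings: "\<pi> \<in> colorings r u \<Longrightarrow> length \<pi> = length u"
  by (auto simp: colorings_def underlying_def)

lemma sum_colorings_snoc:
  fixes f :: "colored list \<Rightarrow> 'a::comm_monoid_add"
  shows "sum f (colorings r (u @ [b])) = (\<Sum>z<r. \<Sum>\<pi>\<in>colorings r u. f (\<pi> @ [(b, z)]))"
proof -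
  have "sum f (colorings r (u @ [b]))
      = (\<Sum>(z, \<pi>) \<in> {..<r} \<times> colorings r u. f (\<pi> @ [(b, z)]))"
  proof (rule sum.reindex_bij_witness[where i = "\<lambda>(z, \<pi>). \<pi> @ [(b, z)]"
          and j = "\<lambda>\<pi>. (snd (last \<pi>), butlast \<pi>)"])
    fix \<pi> assume \<pi>: "\<pi> \<in> colorings r (u @ [b])"
    then obtain \<rho> z where "\<pi> = \<rho> @ [(b, z)]" "map fst \<rho> = u"
      by (auto simp: colorings_def underlying_def map_eq_append_conv)
    with \<pi> show "(case (snd (last \<pi>), butlast \<pi>) of (z, \<pi>) \<Rightarrow> \<pi> @ [(b, z)]) = \<pi>"
        "(snd (last \<pi>), butlast \<pi>) \<in> {..<r} \<times> colorings r u"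
        "(case (snd (last \<pi>), butlast \<pi>) of (z, \<pi>) \<Rightarrow> f (\<pi> @ [(b, z)])) = f \<pi>"
      by (auto simp: colorings_def underlying_def)
  qed (auto simp: colorings_def underlying_def)
  then show ?thesis
    by (simp add: sum.cartesian_product)
qed

text \<open>The last letter is kept apart with a fixed color \<open>c\<close>, because whether there
  is a descent before it depends on \<open>c\<close>; only \<open>c = 0\<close> is wanted in the
  end, but the induction meets every color. Writing the color sum as the sum of
  \<open>i * (z_i - z_(i+1))\<close> leaves the last color with weight
  \<open>Suc (length u)\<close>, which explains the first factor.\<close>

lemma sum_fmaj_colorings:
  fixes x :: "'a::comm_semiring_1"
  assumes "c < r"
  shows "(\<Sum>\<pi>\<in>colorings r u. x ^ fmaj r (\<pi> @ [(a, c)]))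
       = x ^ (Suc (length u) * c) * x ^ major_index (u @ [a])
         * (\<Prod>i = 1..length u. q_bracket r (x ^ i))"
  using assms
proof (induction u arbitrary: a c rule: rev_induct)
  case Nil
  then show ?case
    by (simp add: colorings_Nil fmaj_def maj_F_def col_def major_index_def)
next
  case (snoc b u)
  define m where "m = Suc (length u)"
  define P where "P = (\<Prod>i = 1..length u. q_bracket r (x ^ i))"
  define M where "M = major_index (u @ [b])"
  \<comment> \<open>The number of colors of \<open>b\<close> that make a descent before
    \<open>(a, c)\<close>: those below \<open>c\<close>, and \<open>c\<close> itself if the
    underlying letters descend.\<close>
  define e where "e = (if a < b then Suc c else c)"
  have e: "e \<le> r"
    using snoc.prems by (simp add: e_def)
  have desc: "colored_less (a, c) (b, z) \<longleftrightarrow> z < e" for z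
    by (auto simp: colored_less_def e_def)
  have "(\<Sum>\<pi>\<in>colorings r (u @ [b]). x ^ fmaj r (\<pi> @ [(a, c)]))
      = (\<Sum>z<r. \<Sum>\<pi>\<in>colorings r u. x ^ (fmaj r (\<pi> @ [(b, z)]) + c + m * (if z < e then r else 0)))"
    by (simp add: sum_colorings_snoc fmaj_snoc desc m_def length_colorings cong: sum.cong)
  also have "\<dots> = (\<Sum>z<r. (\<Sum>\<pi>\<in>colorings r u. x ^ fmaj r (\<pi> @ [(b, z)]))
                       * x ^ (c + m * (if z < e then r else 0)))"
    by (simp only: power_add sum_distrib_right mult.assoc)
  \<comment> \<open>The induction hypothesis for the color \<open>z\<close> contributes
    \<open>x ^ (m * z)\<close>, which joins the descent term into a single power of
    \<open>x ^ m\<close>.\<close>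
  also have "\<dots> = (\<Sum>z<r. x ^ c * x ^ M * P * (x ^ m) ^ (z + (if z < e then r else 0)))"
  proof (rule sum.cong)
    fix z assume "z \<in> {..<r}"
    then show "(\<Sum>\<pi>\<in>colorings r u. x ^ fmaj r (\<pi> @ [(b, z)]))
          * x ^ (c + m * (if z < e then r else 0))
        = x ^ c * x ^ M * P * (x ^ m) ^ (z + (if z < e then r else 0))"
      using snoc.IH[of z b]
      by (simp only: lessThan_iff m_def[symmetric] M_def[symmetric] P_def[symmetric] power_add
          power_mult[symmetric] distrib_left mult_ac)
  qed simp
  also have "\<dots> = x ^ c * x ^ M * P * ((x ^ m) ^ e * q_bracket r (x ^ m))"
    by (simp only: sum_distrib_left[symmetric] q_bracket_shift_residues[OF e])
  also have "\<dots> = x ^ (c + M + m * e) * (P * q_bracket r (x ^ m))"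
    by (simp only: power_add power_mult[symmetric] mult_ac)
  \<comment> \<open>The excess of \<open>e\<close> over \<open>c\<close> is \<open>1\<close> exactly
    at an underlying descent, and \<open>m\<close> is the position of that descent.\<close>
  also have "c + M + m * e = Suc m * c + major_index ((u @ [b]) @ [a])"
    by (simp add: e_def M_def m_def major_index_snoc)
  also have "P * q_bracket r (x ^ m) = (\<Prod>i = 1..length (u @ [b]). q_bracket r (x ^ i))"
    by (simp add: P_def m_def)
  finally show ?case
    by (simp add: power_add m_def)
qed

text \<open>Dropping the last letter is a bijection onto \<open>colorings r u\<close>: divisibility
  by \<open>r\<close> determines the last color, and \<open>Dmaj\<close> replaces that color by
  \<open>0\<close>.\<close>

lemma sum_Dmaj_over:
  fixes x :: "'a::comm_semiring_1"
  assumes r: "0 < r" and n: "0 < n" and w: "w \<in> permutations_of_set {1..n}"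
  shows "(\<Sum>\<pi> \<in> colored_perms_star_over r n w. x ^ Dmaj r \<pi>)
       = x ^ major_index w * (\<Prod>i = 1..n - 1. q_bracket r (x ^ i))"
proof -
  have len: "length w = n"
    using length_finite_permutations_of_set[OF w] by simp
  with n obtain u a where ua: "w = u @ [a]"
    by (cases w rule: rev_cases) auto
  \<comment> \<open>The color that completes the sum to a multiple of \<open>r\<close>. The outer
    \<open>mod\<close> turns \<open>r\<close>, which is no color, into \<open>0\<close> when the sum
    is already divisible.\<close>
  define k where "k \<pi> = (r - col \<pi> mod r) mod r" for \<pi>
  have k_less: "k \<pi> < r" for \<pi>
    using r by (simp add: k_def)
  have k_unique: "z = k \<pi>" if "r dvd col \<pi> + z" "z < r" for \<pi> z
  proof -
    have "col \<pi> mod r + z = 0 \<or> col \<pi> mod r + z = r"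
    proof -
      have "r dvd col \<pi> mod r + z"
        using that(1) by (metis dvd_eq_mod_eq_0 mod_add_left_eq)
      then obtain t where t: "col \<pi> mod r + z = r * t" ..
      moreover have "col \<pi> mod r + z < r * 2"
        using that(2) mod_less_divisor[OF r, of "col \<pi>"] by linarith
      ultimately have "t < 2"
        by (metis mult_less_cancel1)
      then show ?thesis
        using t by (auto simp: less_2_cases_iff)
    qed
    then show ?thesis
      using that(2) by (auto simp: k_def)
  qed
  have k_dvd: "r dvd col \<pi> + k \<pi>" for \<pi>
  proof -
    have "(col \<pi> + k \<pi>) mod r = (col \<pi> mod r + (r - col \<pi> mod r)) mod r"
      by (simp add: k_def mod_simps)
    also have "\<dots> = 0"
      using mod_less_divisor[OF r, of "col \<pi>"] by simp
    finally show ?thesis by auto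
  qed
  have "(\<Sum>\<pi> \<in> colored_perms_star_over r n w. x ^ Dmaj r \<pi>)
      = (\<Sum>\<pi>\<in>colorings r u. x ^ fmaj r (\<pi> @ [(a, 0)]))"
  proof (rule sum.reindex_bij_witness[where i = "\<lambda>\<pi>. \<pi> @ [(a, k \<pi>)]" and j = butlast])
    fix \<pi> assume "\<pi> \<in> colored_perms_star_over r n w"
    then have u: "underlying \<pi> = u @ [a]" and c: "\<forall>x\<in>set \<pi>. snd x < r" and d: "r dvd col \<pi>"
      by (auto simp: colored_perms_star_over_def colored_perms_star_def colored_perms_def ua)
    from u obtain \<rho> z where \<pi>: "\<pi> = \<rho> @ [(a, z)]" and \<rho>: "map fst \<rho> = u"
      by (auto simp: underlying_def map_eq_append_conv)
    show "butlast \<pi> @ [(a, k (butlast \<pi>))] = \<pi>"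
      using k_unique[of \<rho> z] c d by (simp add: \<pi> col_def)
    show "butlast \<pi> \<in> colorings r u"
      using \<rho> c by (simp add: \<pi> colorings_def underlying_def)
    show "x ^ fmaj r (butlast \<pi> @ [(a, 0)]) = x ^ Dmaj r \<pi>"
      by (simp add: \<pi> Dmaj_def uncolor_def)
  next
    fix \<pi> assume "\<pi> \<in> colorings r u"
    then show "\<pi> @ [(a, k \<pi>)] \<in> colored_perms_star_over r n w"
      using w k_dvd[of \<pi>] k_less[of \<pi>]
      by (auto simp: ua colorings_def colored_perms_star_over_def colored_perms_star_def
          colored_perms_def underlying_def col_def)
  qed simp
  also have "\<dots> = x ^ major_index w * (\<Prod>i = 1..n - 1. q_bracket r (x ^ i))"
    using sum_fmaj_colorings[OF r, where x = x and u = u and a = a] len by (auto simp: ua)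
  finally show ?thesis .
qed

section \<open>Signs and the major index\<close>

definition cyc_pred :: "nat \<Rightarrow> nat \<Rightarrow> nat" where
  "cyc_pred n x = (if x = 1 then n else x - 1)"

definition cyc_succ :: "nat \<Rightarrow> nat \<Rightarrow> nat" where
  "cyc_succ n x = (if x = n then 1 else Suc x)"

lemma cyc_succ_pred: "x \<in> {1..n} \<Longrightarrow> cyc_succ n (cyc_pred n x) = x"
  by (auto simp: cyc_succ_def cyc_pred_def)

lemma cyc_pred_succ: "x \<in> {1..n} \<Longrightarrow> cyc_pred n (cyc_succ n x) = x"
  by (auto simp: cyc_succ_def cyc_pred_def)

lemma bij_betw_cyc_pred: "bij_betw (cyc_pred n) {1..n} {1..n}"
  by (rule bij_betw_byWitness[where f' = "cyc_succ n"])
    (auto simp: cyc_succ_pred cyc_pred_succ, auto simp: cyc_succ_def cyc_pred_def)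

lemma bij_betw_cyc_succ: "bij_betw (cyc_succ n) {1..n} {1..n}"
  by (rule bij_betw_byWitness[where f' = "cyc_pred n"])
    (auto simp: cyc_succ_pred cyc_pred_succ, auto simp: cyc_succ_def cyc_pred_def)

lemma map_in_permutations_of_set:
  "w \<in> permutations_of_set A \<Longrightarrow> bij_betw f A B \<Longrightarrow> map f w \<in> permutations_of_set B"
  by (auto simp: permutations_of_set_def bij_betw_def distinct_map)

lemma cyc_pred_less_iff:
  "x \<noteq> 1 \<Longrightarrow> y \<noteq> 1 \<Longrightarrow> x \<in> {1..n} \<Longrightarrow> y \<in> {1..n} \<Longrightarrow> cyc_pred n x < cyc_pred n y \<longleftrightarrow> x < y"
  by (auto simp: cyc_pred_def)

lemma cyc_pred_less_n: "x \<noteq> 1 \<Longrightarrow> x \<in> {1..n} \<Longrightarrow> cyc_pred n x < n"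
  by (auto simp: cyc_pred_def)

text \<open>Only comparisons with the entry \<open>1\<close>, at index \<open>p\<close>, change: it
  becomes the maximum \<open>n\<close>, while the other entries keep their relative order. Its
  descent moves from position \<open>p\<close> to \<open>Suc p\<close>. The \<open>p\<close>
  inversions with earlier entries vanish and \<open>n - 1 - p\<close> with later entries
  appear.\<close>

lemma
  assumes w: "w \<in> permutations_of_set {1..n}" and n: "0 < n"
  shows major_index_cyc_pred:
      "last w \<noteq> 1 \<Longrightarrow> major_index (map (cyc_pred n) w) = Suc (major_index w)"
    and inversions_cyc_pred:
      "\<exists>p<n. inversions (map (cyc_pred n) w) + p = inversions w + (n - 1 - p)"
proof -
  let ?v = "map (cyc_pred n) w"
  have len: "length w = n"
    using length_finite_permutations_of_set[OF w] by simp
  have set: "set w = {1..n}" and dist: "distinct w"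
    using w by (auto simp: permutations_of_set_def)
  have "1 \<in> set w"
    using set n by simp
  then obtain p where p: "p < n" "w ! p = 1"
    by (metis in_set_conv_nth len)
  have v_p: "?v ! p = n"
    using p len by (simp add: cyc_pred_def)
  have mem: "w ! i \<in> {1..n}" if "i < n" for i
    using that len set by (metis nth_mem)
  have ne1: "w ! i \<noteq> 1" if "i < n" "i \<noteq> p" for i
    using that p dist len by (metis nth_eq_iff_index_eq)
  have gt1: "w ! i > 1" if "i < n" "i \<noteq> p" for i
    using ne1[OF that] mem[OF that(1)] by auto
  have lt_n: "?v ! i < n" if "i < n" "i \<noteq> p" for i
    using that ne1[OF that] mem[OF that(1)] len by (simp add: cyc_pred_less_n)
  have less: "?v ! i < ?v ! j \<longleftrightarrow> w ! i < w ! j" if "i < n" "j < n" "i \<noteq> p" "j \<noteq> p" for i j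
    using that ne1 mem len by (simp add: cyc_pred_less_iff)
  show "major_index ?v = Suc (major_index w)" if "last w \<noteq> 1"
  proof -
    \<comment> \<open>Since \<open>1\<close> is not last, the new descent position
      \<open>Suc p\<close> is in range.\<close>
    have "w \<noteq> []"
      using n len by auto
    then have "p \<noteq> n - 1"
      using that p len by (auto simp: last_conv_nth)
    with p have p': "Suc p < n" by simp
    define f where "f l i = (if l ! (i - 1) > l ! i then i else 0)" for l :: "nat list" and i
    have maj: "major_index l = (\<Sum>i\<in>{1..<length l}. f l i)" for l
      unfolding major_index_def f_def by (simp add: sum.inter_filter[symmetric])
    \<comment> \<open>The lost and the gained descent are added on opposite sides to avoid
      subtraction. For \<open>p = 0\<close> no descent is lost, and the weight \<open>p\<close> is
      \<open>0\<close> as well.\<close>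
    have "f ?v i + (if i = p then p else 0) = f w i + (if i = Suc p then Suc p else 0)"
      if "i \<in> {1..<n}" for i
    proof -
      consider "i = p" | "i = Suc p" | "i \<noteq> p" "i - 1 \<noteq> p"
        using that by force
      then show ?thesis
      proof cases
        case 1
        then have "p - 1 < n" "p - 1 \<noteq> p"
          using that by auto
        then show ?thesis
          using 1 p v_p gt1[of "p - 1"] lt_n[of "p - 1"]
          by (simp add: f_def del: nth_map)
      next
        case 2
        then show ?thesis
          using that p v_p gt1[of i] lt_n[of i] len
            by (simp add: f_def del: nth_map)
      next
        case 3
        moreover have "i - 1 < n"
          using that by auto
        ultimately show ?thesis
          using that less[of i "i - 1"] by (auto simp: f_def simp del: nth_map)
      qed
    qed
    then have "(\<Sum>i\<in>{1..<n}. f ?v i + (if i = p then p else 0))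
        = (\<Sum>i\<in>{1..<n}. f w i + (if i = Suc p then Suc p else 0))"
      by (rule sum.cong[OF refl])
    then have "(\<Sum>i\<in>{1..<n}. f ?v i) + p = (\<Sum>i\<in>{1..<n}. f w i) + Suc p"
      using p p' by (cases "p = 0") (simp_all add: sum.distrib)
    then show ?thesis
      by (simp add: maj len)
  qed
  show "\<exists>p<n. inversions ?v + p = inversions w + (n - 1 - p)"
  proof (intro exI conjI)
    define I where "I l = {(i, j). i < j \<and> j < n \<and> l ! i > l ! j}" for l :: "nat list"
    \<comment> \<open>\<open>?L\<close> holds the inversions that are lost and \<open>?R\<close>
      those that are gained; adding each to the side that lacks it gives equal sets.\<close>
    let ?L = "{..<p} \<times> {p}" and ?R = "{p} \<times> {p<..<n}"
    have fin: "finite (I l)" for l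
      by (rule finite_subset[of _ "{..<n} \<times> {..<n}"]) (auto simp: I_def)
    have inv: "inversions w = card (I w)" "inversions ?v = card (I ?v)"
      by (simp_all add: inversions_def I_def len)
    have L: "?L \<subseteq> I w" and R: "?R \<subseteq> I ?v"
      using p v_p gt1 lt_n by (auto simp: I_def)
    have "(i, p) \<notin> I ?v" if "i < p" for i
      using p v_p lt_n[of i] that by (simp add: I_def del: nth_map)
    moreover have "(p, j) \<notin> I w" if "p < j" "j < n" for j
      using p gt1[of j] that by (simp add: I_def)
    ultimately have "I ?v \<inter> ?L = {}" "I w \<inter> ?R = {}"
      by auto
    moreover have "I ?v \<union> ?L = I w \<union> ?R"
    proof (rule set_eqI, clarify)
      fix i j
      show "(i, j) \<in> I ?v \<union> ?L \<longleftrightarrow> (i, j) \<in> I w \<union> ?R"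
      proof (cases "i < j \<and> j < n")
        case False
        then show ?thesis
          using p by (auto simp: I_def)
      next
        case True
        consider "i = p" | "j = p" | "i \<noteq> p" "j \<noteq> p"
          by blast
        then show ?thesis
        proof cases
          case 1
          then show ?thesis
            using True R by (auto simp: subset_iff)
        next
          case 2
          then show ?thesis
            using True L by (auto simp: subset_iff)
        next
          case 3
          then show ?thesis
            using True less[of j i] by (auto simp: I_def)
        qed
      qed
    qed
    ultimately have "card (I ?v) + card ?L = card (I w) + card ?R"
      using fin card_Un_disjoint[of "I ?v" ?L] card_Un_disjoint[of "I w" ?R] by simp
    then show "inversions ?v + p = inversions w + (n - 1 - p)"
      by (simp add: inv)
  qed (rule p)
qed

text \<open>The inversion number changes by \<open>n - 1 - 2 * p\<close>, which has the parity of
  \<open>n - 1\<close>, and powers of \<open>e\<close> depend on parity only.\<close>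

lemma sign_inversions_cyc_pred:
  fixes e :: "'a::comm_ring_1"
  assumes w: "w \<in> permutations_of_set {1..n}" and n: "0 < n" and e: "e ^ 2 = 1"
  shows "e ^ inversions (map (cyc_pred n) w) = e ^ (n - 1) * e ^ inversions w"
proof -
  obtain p where p: "p < n" "inversions (map (cyc_pred n) w) + p = inversions w + (n - 1 - p)"
    using inversions_cyc_pred[OF w n] by blast
  have even: "e ^ (2 * k) = 1" for k
    by (simp add: power_mult e)
  have "e ^ inversions (map (cyc_pred n) w) = e ^ (inversions (map (cyc_pred n) w) + 2 * p)"
    by (simp add: power_add even)
  also have "inversions (map (cyc_pred n) w) + 2 * p = (n - 1) + inversions w"
    using p by simp
  finally show ?thesis
    by (simp add: power_add)
qed

section \<open>Signed major-index distribution on the symmetric group\<close>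

lemma inversions_snoc_max:
  assumes "\<And>x. x \<in> set u \<Longrightarrow> x \<le> m"
  shows "inversions (u @ [m]) = inversions u"
proof -
  have "{(i, j). i < j \<and> j < length (u @ [m]) \<and> (u @ [m]) ! i > (u @ [m]) ! j}
      = {(i, j). i < j \<and> j < length u \<and> u ! i > u ! j}"
    using assms by (auto simp: nth_append less_Suc_eq leD)
  then show ?thesis
    by (simp add: inversions_def)
qed

lemma major_index_snoc_max:
  assumes "\<And>x. x \<in> set u \<Longrightarrow> x \<le> m"
  shows "major_index (u @ [m]) = major_index u"
proof (cases u rule: rev_cases)
  case (snoc v b)
  then show ?thesis
    using assms[of b] by (simp add: major_index_snoc)
qed (simp add: major_index_def)

text \<open>The classes by last value have sums in geometric progression with ratio
  \<open>e ^ (n - 1) * x\<close>, which yields the bracket for \<open>i = n\<close>; the class with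
  last value \<open>n\<close> yields the product for \<open>n - 1\<close>. For \<open>e = 1\<close>
  this is MacMahon's formula.\<close>

lemma sum_sign_maj_permutations:
  fixes e x :: "'a::comm_ring_1"
  assumes e: "e ^ 2 = 1"
  shows "(\<Sum>w\<in>permutations_of_set {1..n}. e ^ inversions w * x ^ major_index w)
       = (\<Prod>i = 1..n. q_bracket i (e ^ (i - 1) * x))"
proof (induction n)
  case 0
  then show ?case
    by (simp add: inversions_def major_index_def)
next
  case (Suc n)
  define f where "f w = e ^ inversions w * x ^ major_index w" for w
  define P where "P = permutations_of_set {1..Suc n}"
  define S where "S a = (\<Sum>w\<in>{w \<in> P. last w = a}. f w)" for a
  have ne: "w \<noteq> []" and last_in: "last w \<in> {1..Suc n}" if "w \<in> P" for w
  proof -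
    have "set w = {1..Suc n}"
      using that by (simp add: P_def permutations_of_set_def)
    then show "w \<noteq> []" by auto
    then show "last w \<in> {1..Suc n}"
      using \<open>set w = {1..Suc n}\<close> last_in_set by blast
  qed
  \<comment> \<open>Cyclic lowering maps last value \<open>Suc a\<close> to \<open>a\<close>. As
    \<open>Suc a\<close> is not \<open>1\<close>, the major index grows by one; on
    \<open>Suc n\<close> letters the sign factor is \<open>e ^ n\<close>.\<close>
  have step: "S a = e ^ n * x * S (Suc a)" if a: "1 \<le> a" "a \<le> n" for a
  proof -
    have "(\<Sum>w\<in>{w \<in> P. last w = Suc a}. e ^ n * x * f w) = S a"
      unfolding S_def
    proof (rule sum.reindex_bij_witness[where i = "map (cyc_succ (Suc n))"
          and j = "map (cyc_pred (Suc n))"])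
      fix w assume w: "w \<in> {w \<in> P. last w = Suc a}"
      then have wP: "w \<in> permutations_of_set {1..Suc n}" and l: "last w = Suc a" "w \<noteq> []"
        using ne by (auto simp: P_def)
      have "set w = {1..Suc n}"
        using wP by (simp add: permutations_of_set_def)
      then show "map (cyc_succ (Suc n)) (map (cyc_pred (Suc n)) w) = w"
        by (auto simp: cyc_succ_pred intro!: map_idI)
      show "map (cyc_pred (Suc n)) w \<in> {w \<in> P. last w = a}"
        using map_in_permutations_of_set[OF wP bij_betw_cyc_pred] a l
        by (simp add: P_def last_map cyc_pred_def)
      show "f (map (cyc_pred (Suc n)) w) = e ^ n * x * f w"
        using a l sign_inversions_cyc_pred[OF wP _ e] major_index_cyc_pred[OF wP]
        by (simp add: f_def mult_ac)
    next
      fix w assume w: "w \<in> {w \<in> P. last w = a}"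
      then have wP: "w \<in> permutations_of_set {1..Suc n}" and l: "last w = a" "w \<noteq> []"
        using ne by (auto simp: P_def)
      have "set w = {1..Suc n}"
        using wP by (simp add: permutations_of_set_def)
      then show "map (cyc_pred (Suc n)) (map (cyc_succ (Suc n)) w) = w"
        by (auto simp: cyc_pred_succ intro!: map_idI)
      show "map (cyc_succ (Suc n)) w \<in> {w \<in> P. last w = Suc a}"
        using map_in_permutations_of_set[OF wP bij_betw_cyc_succ] a l
        by (simp add: P_def last_map cyc_succ_def)
    qed
    then show ?thesis
      by (simp add: S_def sum_distrib_left)
  qed
  have S: "S (Suc n - j) = (e ^ n * x) ^ j * S (Suc n)" if "j < Suc n" for j
    using that
  proof (induction j)
    case (Suc j)
    then show ?case
      using step[of "n - j"] by (simp add: Suc_diff_le mult_ac)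
  qed simp
  \<comment> \<open>A maximal last letter creates neither an inversion nor a descent, so it can be
    deleted.\<close>
  have top: "S (Suc n) = (\<Sum>u\<in>permutations_of_set {1..n}. f u)"
    unfolding S_def
  proof (rule sum.reindex_bij_witness[where i = "\<lambda>u. u @ [Suc n]" and j = butlast])
    fix w assume "w \<in> {w \<in> P. last w = Suc n}"
    then have w: "distinct w" "set w = {1..Suc n}" "last w = Suc n" "w \<noteq> []"
      using ne by (auto simp: P_def permutations_of_set_def)
    then obtain u where u: "w = u @ [Suc n]"
      by (metis append_butlast_last_id)
    have "set u = set w - {Suc n}"
      using w(1) by (auto simp: u)
    also have "\<dots> = {1..n}"
      unfolding w(2) by auto
    finally have su: "set u = {1..n}" .
    show "butlast w @ [Suc n] = w"
      by (simp add: u)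
    show "butlast w \<in> permutations_of_set {1..n}"
      using w(1) su by (simp add: u permutations_of_set_def)
    show "f (butlast w) = f w"
      using su inversions_snoc_max[of u "Suc n"] major_index_snoc_max[of u "Suc n"]
      by (simp add: u f_def)
  next
    fix u assume "u \<in> permutations_of_set {1..n}"
    then show "u @ [Suc n] \<in> {w \<in> P. last w = Suc n}"
      by (auto simp: P_def permutations_of_set_def)
  qed simp
  have "(\<Sum>w\<in>P. f w) = (\<Sum>a\<in>{1..Suc n}. S a)"
    unfolding S_def by (rule sum.group[symmetric]) (use last_in in \<open>auto simp: P_def\<close>)
  also have "\<dots> = (\<Sum>j<Suc n. S (Suc n - j))"
    by (rule sum.reindex_bij_witness[where i = "\<lambda>j. Suc n - j" and j = "\<lambda>a. Suc n - a"]) auto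
  also have "\<dots> = (\<Sum>j<Suc n. (e ^ n * x) ^ j * S (Suc n))"
    by (rule sum.cong) (use S in auto)
  also have "\<dots> = q_bracket (Suc n) (e ^ n * x) * S (Suc n)"
    by (simp only: q_bracket_def sum_distrib_right)
  also have "S (Suc n) = (\<Prod>i = 1..n. q_bracket i (e ^ (i - 1) * x))"
    using Suc.IH by (simp only: top f_def)
  finally show ?case
    by (simp add: f_def P_def mult.commute)
qed

section \<open>Merging the brackets and assembling the two identities\<close>

text \<open>Division by \<open>i\<close> with remainder splits the exponents below
  \<open>i * r\<close> into \<open>r\<close> blocks of length \<open>i\<close>; the induction adds
  one block at a time.\<close>

lemma q_bracket_mult:
  fixes x :: "'a::comm_semiring_1"
  shows "q_bracket (i * r) x = q_bracket i x * q_bracket r (x ^ i)"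
proof (induction r)
  case 0
  then show ?case by (simp add: q_bracket_def)
next
  case (Suc r)
  have "q_bracket (i * Suc r) x = q_bracket (i * r) x + (\<Sum>k = i * r..<i + i * r. x ^ k)"
    unfolding q_bracket_def lessThan_atLeast0
    using sum.atLeastLessThan_concat[of 0 "i * r" "i + i * r" "\<lambda>k. x ^ k"] by simp
  also have "(\<Sum>k = i * r..<i + i * r. x ^ k) = q_bracket i x * (x ^ i) ^ r"
    using sum.shift_bounds_nat_ivl[of "\<lambda>k. x ^ k" 0 "i * r" i]
    by (simp add: q_bracket_def atLeast0LessThan power_add power_mult sum_distrib_right)
  also have "q_bracket (i * r) x + \<dots> = q_bracket i x * (q_bracket r (x ^ i) + (x ^ i) ^ r)"
    by (simp only: Suc distrib_left)
  finally show ?case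
    by (simp add: q_bracket_def)
qed

theorem theorem6p1:
  fixes r n :: nat and \<epsilon> :: int
  assumes "0 < r" and "0 < n" and "\<epsilon> \<in> {1, -1}"
  shows "(\<forall>w \<in> permutations_of_set {1..n}.
            (\<Sum>\<pi> \<in> colored_perms_star_over r n w.
               smult (\<epsilon> ^ inversions (underlying \<pi>)) (qq ^ Dmaj r \<pi>))
            = smult (\<epsilon> ^ inversions w) (qq ^ major_index w)
              * (\<Prod>i = 1..n - 1. q_bracket r (qq ^ i)))
       \<and> (\<Sum>\<pi> \<in> colored_perms_star r n.
             smult (\<epsilon> ^ inversions (underlying \<pi>)) (qq ^ Dmaj r \<pi>))
         = (\<Prod>i = 1..n - 1. q_bracket (i * r) (smult (\<epsilon> ^ (i - 1)) qq))
           * q_bracket n (smult (\<epsilon> ^ (n - 1)) qq)"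
proof (intro conjI ballI)
  define R where "R = (\<Prod>i = 1..n - 1. q_bracket r (qq ^ i))"
  \<comment> \<open>The sign as a constant polynomial, so that the identities over a general ring
    apply with \<open>x = qq\<close>.\<close>
  define e where "e = [:\<epsilon>:]"
  have smult_e: "smult (\<epsilon> ^ k) p = e ^ k * p" for k p
    by (simp add: e_def poly_const_pow)
  have e: "e ^ 2 = 1"
    using assms(3) by (auto simp: e_def poly_const_pow)
  let ?f = "\<lambda>\<pi>. smult (\<epsilon> ^ inversions (underlying \<pi>)) (qq ^ Dmaj r \<pi>)"
  show over: "sum ?f (colored_perms_star_over r n w)
      = smult (\<epsilon> ^ inversions w) (qq ^ major_index w) * (\<Prod>i = 1..n - 1. q_bracket r (qq ^ i))"
    if w: "w \<in> permutations_of_set {1..n}" for w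
  proof -
    have "sum ?f (colored_perms_star_over r n w)
        = (\<Sum>\<pi>\<in>colored_perms_star_over r n w. e ^ inversions w * qq ^ Dmaj r \<pi>)"
      by (rule sum.cong) (auto simp: smult_e colored_perms_star_over_def)
    also have "\<dots> = e ^ inversions w * (\<Sum>\<pi>\<in>colored_perms_star_over r n w. qq ^ Dmaj r \<pi>)"
      by (simp only: sum_distrib_left)
    finally show ?thesis
      by (simp only: sum_Dmaj_over[OF assms(1,2) w] smult_e mult.assoc)
  qed
  have "sum ?f (colored_perms_star r n)
      = (\<Sum>w\<in>permutations_of_set {1..n}. sum ?f (colored_perms_star_over r n w))"
    unfolding colored_perms_star_over_def
    by (rule sum.group[symmetric])
      (use finite_colored_perms[of r n] in \<open>simp add: colored_perms_star_def\<close>,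
        auto simp: colored_perms_star_def colored_perms_def)
  also have "\<dots> = (\<Sum>w\<in>permutations_of_set {1..n}. e ^ inversions w * qq ^ major_index w * R)"
  proof (rule sum.cong)
    fix w :: "nat list" assume "w \<in> permutations_of_set {1..n}"
    from over[OF this] show "sum ?f (colored_perms_star_over r n w)
        = e ^ inversions w * qq ^ major_index w * R"
      by (simp only: R_def smult_e)
  qed simp
  also have "\<dots> = (\<Sum>w\<in>permutations_of_set {1..n}. e ^ inversions w * qq ^ major_index w) * R"
    by (simp only: sum_distrib_right)
  also have "\<dots> = (\<Prod>i = 1..n. q_bracket i (e ^ (i - 1) * qq)) * R"
    by (simp only: sum_sign_maj_permutations[OF e])
  \<comment> \<open>The factor \<open>i = n\<close> is split off because \<open>R\<close> has only
    \<open>n - 1\<close> brackets to pair with.\<close>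
  also have "(\<Prod>i = 1..n. q_bracket i (e ^ (i - 1) * qq))
      = (\<Prod>i = 1..n - 1. q_bracket i (e ^ (i - 1) * qq)) * q_bracket n (e ^ (n - 1) * qq)"
    using assms(2) by (cases n) simp_all
  also have "\<dots> * R = (\<Prod>i = 1..n - 1. q_bracket i (e ^ (i - 1) * qq) * q_bracket r (qq ^ i))
      * q_bracket n (e ^ (n - 1) * qq)"
    by (simp only: R_def prod.distrib mult_ac)
  also have "(\<Prod>i = 1..n - 1. q_bracket i (e ^ (i - 1) * qq) * q_bracket r (qq ^ i))
      = (\<Prod>i = 1..n - 1. q_bracket (i * r) (e ^ (i - 1) * qq))"
  proof (rule prod.cong)
    fix i :: nat assume "i \<in> {1..n - 1}"
    \<comment> \<open>Hence the sign disappears from the \<open>i\<close>-th power of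
      \<open>e ^ (i - 1) * qq\<close>, leaving \<open>qq ^ i\<close>, as
      \<open>q_bracket_mult\<close> requires.\<close>
    have "even ((i - 1) * i)"
      by (cases i) auto
    then obtain k where "(i - 1) * i = 2 * k" ..
    then have "(e ^ (i - 1)) ^ i = (e ^ 2) ^ k"
      by (simp only: power_mult[symmetric])
    then have "(e ^ (i - 1)) ^ i = 1"
      by (simp add: e)
    then show "q_bracket i (e ^ (i - 1) * qq) * q_bracket r (qq ^ i)
        = q_bracket (i * r) (e ^ (i - 1) * qq)"
      by (simp add: q_bracket_mult power_mult_distrib)
  qed simp
  finally show "sum ?f (colored_perms_star r n)
      = (\<Prod>i = 1..n - 1. q_bracket (i * r) (smult (\<epsilon> ^ (i - 1)) qq))
        * q_bracket n (smult (\<epsilon> ^ (n - 1)) qq)"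
    by (simp only: smult_e[symmetric])
qed

end
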